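(* Let $t,s$ be integers with $4 \leq t \leq s \leq \frac{13t+37}{2}$ and let $G=C_3^tC_4^s$. Then $G$ is graceful when $t\equiv 0,1\pmod 4$ and near graceful when $t\equiv 2,3\pmod 4$.
   Context: $C_n^t$ denotes the union of $t$ cycles of length $n$ sharing exactly one common (central) vertex, and $C_3^tC_4^s$ denotes the graph obtained by identifying the central vertices of $C_3^t$ and $C_4^s$. For a graph $G$ with $m$ edges, a graceful labelling is an injective map $f:V(G)\to\{0,\ldots,m\}$ such that $g(uv)=|f(u)-f(v)|$ is a bijection $E(G)\to\{1,\ldots,m\}$. A near graceful labelling is an injective map $f:V(G)\to\{0,\ldots,m+1\}$ such that $g(uv)=|f(u)-f(v)|$ is a bijection onto $\{1,\ldots,m-1,m\}$ or onto $\{1,\ldots,m-1,m+1\}$. A graph is (near) graceful if it admits such a labelling. *)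

theory Defs
  imports Complex_Main
begin

text \<open>A simple undirected graph is a pair of a vertex set and a set of two-element edges.\<close>

type_synonym 'a graph = "'a set \<times> 'a set set"

abbreviation verts :: "'a graph \<Rightarrow> 'a set" where
  "verts G \<equiv> fst G"

abbreviation edges :: "'a graph \<Rightarrow> 'a set set" where
  "edges G \<equiv> snd G"

definition simple_graph :: "'a graph \<Rightarrow> bool" where
  "simple_graph G \<longleftrightarrow> finite (verts G) \<and> (\<forall>e\<in>edges G. e \<subseteq> verts G \<and> card e = 2)"

definition map_graph :: "('a \<Rightarrow> 'b) \<Rightarrow> 'a graph \<Rightarrow> 'b graph" where
  "map_graph h G = (h ` verts G, (`) h ` edges G)"

definition graph_union :: "'a graph \<Rightarrow> 'a graph \<Rightarrow> 'a graph" where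
  "graph_union G H = (verts G \<union> verts H, edges G \<union> edges H)"

text \<open>The cycle of length \<open>n\<close> (a simple graph with \<open>n\<close> edges for \<open>n \<ge> 3\<close>).\<close>

definition cycle_graph :: "nat \<Rightarrow> nat graph" where
  "cycle_graph n = ({..<n}, (\<lambda>j. {j, Suc j mod n}) ` {..<n})"

text \<open>\<open>cycle_bouquet n t\<close> is the graph $C_n^t$: the \<open>i\<close>-th cycle has vertex \<open>0\<close> renamed to
  \<open>Center\<close> and every other vertex \<open>j\<close> renamed to \<open>Rim i j\<close>.\<close>

datatype bouquet_vertex = Center | Rim nat nat

definition bouquet_vertex_of :: "nat \<Rightarrow> nat \<Rightarrow> bouquet_vertex" where
  "bouquet_vertex_of i j = (if j = 0 then Center else Rim i j)"

definition cycle_bouquet :: "nat \<Rightarrow> nat \<Rightarrow> bouquet_vertex graph" where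
  "cycle_bouquet n t =
     ({Center} \<union> (\<Union>i<t. verts (map_graph (bouquet_vertex_of i) (cycle_graph n))),
      (\<Union>i<t. edges (map_graph (bouquet_vertex_of i) (cycle_graph n))))"

text \<open>The disjoint union of \<open>G\<close> and \<open>H\<close> with \<open>u\<close> in \<open>G\<close> and \<open>v\<close> in \<open>H\<close> identified;
  the identified vertex is represented by \<open>Inl u\<close>.\<close>

definition identify_vertices :: "'a graph \<Rightarrow> 'a \<Rightarrow> 'b graph \<Rightarrow> 'b \<Rightarrow> ('a + 'b) graph" where
  "identify_vertices G u H v =
     graph_union (map_graph Inl G) (map_graph (\<lambda>x. if x = v then Inl u else Inr x) H)"

definition C3C4_graph :: "nat \<Rightarrow> nat \<Rightarrow> (bouquet_vertex + bouquet_vertex) graph" where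
  "C3C4_graph t s = identify_vertices (cycle_bouquet 3 t) Center (cycle_bouquet 4 s) Center"

definition induced_edge_labelling :: "'a graph \<Rightarrow> ('a \<Rightarrow> int) \<Rightarrow> ('a set \<Rightarrow> int) \<Rightarrow> bool" where
  "induced_edge_labelling G f g \<longleftrightarrow> (\<forall>u v. {u, v} \<in> edges G \<longrightarrow> g {u, v} = \<bar>f u - f v\<bar>)"

definition graceful_labelling :: "'a graph \<Rightarrow> ('a \<Rightarrow> int) \<Rightarrow> bool" where
  "graceful_labelling G f \<longleftrightarrow>
     (let m = int (card (edges G)) in
        inj_on f (verts G) \<and> f ` verts G \<subseteq> {0..m} \<and>
        (\<exists>g. induced_edge_labelling G f g \<and> bij_betw g (edges G) {1..m}))"

definition near_graceful_labelling :: "'a graph \<Rightarrow> ('a \<Rightarrow> int) \<Rightarrow> bool" where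
  "near_graceful_labelling G f \<longleftrightarrow>
     (let m = int (card (edges G)) in
        inj_on f (verts G) \<and> f ` verts G \<subseteq> {0..m + 1} \<and>
        (\<exists>g. induced_edge_labelling G f g \<and>
             (bij_betw g (edges G) {1..m} \<or> bij_betw g (edges G) ({1..m - 1} \<union> {m + 1}))))"

definition graceful :: "'a graph \<Rightarrow> bool" where
  "graceful G \<longleftrightarrow> (\<exists>f. graceful_labelling G f)"

definition near_graceful :: "'a graph \<Rightarrow> bool" where
  "near_graceful G \<longleftrightarrow> (\<exists>f. near_graceful_labelling G f)"

lemma cycle_graph_3: "cycle_graph 3 = ({0,1,2}, {{0,1},{1,2},{2,0}})"
  by (simp add: cycle_graph_def lessThan_nat_numeral lessThan_Suc insert_commute flip: numeral_2_eq_2)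

lemma cycle_graph_4: "cycle_graph 4 = ({0,1,2,3}, {{0,1},{1,2},{2,3},{3,0}})"
  by (simp add: cycle_graph_def lessThan_nat_numeral lessThan_Suc insert_commute flip: numeral_2_eq_2)

lemma verts_C3C4_graph:
  "verts (C3C4_graph t s) =
     {Inl Center} \<union> (\<Union>i<t. {Inl (Rim i 1), Inl (Rim i 2)})
     \<union> (\<Union>i<s. {Inr (Rim i 1), Inr (Rim i 2), Inr (Rim i 3)})"
  by (simp add: C3C4_graph_def identify_vertices_def graph_union_def map_graph_def
      cycle_bouquet_def cycle_graph_3 cycle_graph_4 bouquet_vertex_of_def image_UN) blast

lemma edges_C3C4_graph:
  "edges (C3C4_graph t s) =
     (\<Union>i<t. {{Inl (Rim i 1), Inl Center}, {Inl (Rim i 1), Inl (Rim i 2)},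
              {Inl (Rim i 2), Inl Center}})
     \<union> (\<Union>i<s. {{Inr (Rim i 1), Inl Center}, {Inr (Rim i 1), Inr (Rim i 2)},
                {Inr (Rim i 2), Inr (Rim i 3)}, {Inr (Rim i 3), Inl Center}})"
  by (simp add: C3C4_graph_def identify_vertices_def graph_union_def map_graph_def
      cycle_bouquet_def cycle_graph_3 cycle_graph_4 bouquet_vertex_of_def image_UN insert_commute)

lemma simple_graph_C3C4_graph: "simple_graph (C3C4_graph t s)"
  by (simp add: simple_graph_def verts_C3C4_graph edges_C3C4_graph ball_Un)

lemma card_edges_C3C4_graph: "card (edges (C3C4_graph t s)) = 3 * t + 4 * s"
proof -
  define A :: "nat \<Rightarrow> (bouquet_vertex + bouquet_vertex) set set" where
    "A = (\<lambda>i. {{Inl (Rim i 1), Inl Center}, {Inl (Rim i 1), Inl (Rim i 2)},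
              {Inl (Rim i 2), Inl Center}})"
  define B :: "nat \<Rightarrow> (bouquet_vertex + bouquet_vertex) set set" where
    "B = (\<lambda>i. {{Inr (Rim i 1), Inl Center}, {Inr (Rim i 1), Inr (Rim i 2)},
              {Inr (Rim i 2), Inr (Rim i 3)}, {Inr (Rim i 3), Inl Center}})"
  have fin: "finite (A i)" "finite (B i)" for i
    by (simp_all add: A_def B_def)
  have card: "card (A i) = 3" "card (B i) = 4" for i
    by (simp_all add: A_def B_def doubleton_eq_iff)
  have A: "A i \<inter> A j = {}" "B i \<inter> B j = {}" if "i \<noteq> j" for i j
    using that by (simp_all add: A_def B_def doubleton_eq_iff)
  have AB: "A i \<inter> B j = {}" for i j
    by (simp add: A_def B_def doubleton_eq_iff)
  have "card (\<Union>i<t. A i) = 3 * t" "card (\<Union>i<s. B i) = 4 * s"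
    using fin A by (simp_all add: card_UN_disjoint card)
  moreover have "card ((\<Union>i<t. A i) \<union> (\<Union>i<s. B i)) = card (\<Union>i<t. A i) + card (\<Union>i<s. B i)"
    using fin AB by (intro card_Un_disjoint) blast+
  ultimately show ?thesis
    by (simp add: edges_C3C4_graph A_def B_def)
qed

end

theory Submission
  imports Defs
begin

text \<open>
  Give the central vertex the label \<open>0\<close> and let \<open>w = t + 4s\<close>. The triangles take the edge labels
  \<open>1..t\<close> and the \<open>2t\<close> labels above \<open>w\<close>: a Skolem sequence (hooked if \<open>t\<close> is \<open>2\<close> or \<open>3\<close> modulo \<open>4\<close>)
  splits the latter into pairs with differences \<open>1, \<dots>, t\<close>. The squares \<open>0, x, y, z\<close> take the
  labels \<open>t + 1..w\<close>. A block of \<open>2k + 1\<close> squares uses the labels \<open>u + 1..u + 8k + 4\<close>: the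
  upper half is adjacent to the centre, the lower half consists of the labels \<open>x - y\<close> and
  \<open>z - y\<close>, and the opposite vertices \<open>y\<close> fill the interval from \<open>3k + 2\<close> to \<open>5k + 2\<close>. For
  \<open>k \<le> u\<close> this interval lies below the upper half, and for \<open>u < 3k + 2\<close> it lies above all vertex
  labels of a preceding block. One or two blocks and at most one extra square give every
  required \<open>s\<close>.

  Since the number of edges is known, it suffices to show that each label occurs on an edge. The
  neighbours of the centre then have distinct labels, because these are the labels of the edges
  joining them to the centre.
\<close>

section \<open>Labellings by differences\<close>

definition edge_diff :: "('a \<Rightarrow> nat) \<Rightarrow> 'a set \<Rightarrow> nat" where
  "edge_diff f e = Max (f ` e) - Min (f ` e)"

lemma edge_diff_doubleton: "edge_diff f {v, w} = max (f v) (f w) - min (f v) (f w)"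
  by (simp add: edge_diff_def)

lemma truncated_diff_in_edge_diff_image:
  assumes "{v, w} \<in> E"
  shows "f v - f w \<in> insert 0 (edge_diff f ` E)"
proof (cases "f v \<le> f w")
  case False
  then have "f v - f w = edge_diff f {v, w}"
    by (simp add: edge_diff_doubleton)
  with assms show ?thesis
    by blast
qed simp

definition difference_labelling :: "'a graph \<Rightarrow> ('a \<Rightarrow> nat) \<Rightarrow> nat \<Rightarrow> nat set \<Rightarrow> bool" where
  "difference_labelling G f N T \<longleftrightarrow>
     inj_on f (verts G) \<and> f ` verts G \<subseteq> {..N} \<and> bij_betw (edge_diff f) (edges G) T"

lemma difference_labelling_int:
  assumes "difference_labelling G f N T"
  shows "inj_on (int \<circ> f) (verts G)" "(int \<circ> f) ` verts G \<subseteq> {0..int N}"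
    "induced_edge_labelling G (int \<circ> f) (int \<circ> edge_diff f)"
    "bij_betw (int \<circ> edge_diff f) (edges G) (int ` T)"
proof -
  show "inj_on (int \<circ> f) (verts G)" "(int \<circ> f) ` verts G \<subseteq> {0..int N}"
    using assms by (auto simp: difference_labelling_def intro: comp_inj_on)
  show "induced_edge_labelling G (int \<circ> f) (int \<circ> edge_diff f)"
    by (auto simp: induced_edge_labelling_def edge_diff_doubleton max_def min_def)
  show "bij_betw (int \<circ> edge_diff f) (edges G) (int ` T)"
    using assms by (auto simp: difference_labelling_def intro: bij_betw_trans inj_on_imp_bij_betw)
qed

lemma graceful_if_difference_labelling:
  assumes "difference_labelling G f (card (edges G)) {1..card (edges G)}"
  shows "graceful G"
proof -
  have "int ` {1..card (edges G)} = {1..int (card (edges G))}"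
    by (simp add: image_int_atLeastAtMost)
  then show ?thesis
    using difference_labelling_int[OF assms]
    unfolding graceful_def graceful_labelling_def Let_def by metis
qed

lemma near_graceful_if_difference_labelling:
  assumes "difference_labelling G f (card (edges G) + 1)
    ({1..card (edges G) - 1} \<union> {card (edges G) + 1})"
  shows "near_graceful G"
proof -
  define m where "m = card (edges G)"
  have "int ` ({1..m - 1} \<union> {m + 1}) = {1..int m - 1} \<union> {int m + 1}"
    by (cases m) (auto simp: image_Un image_int_atLeastAtMost)
  moreover have "int (m + 1) = int m + 1" by simp
  ultimately show ?thesis
    using difference_labelling_int[OF assms, folded m_def]
    unfolding near_graceful_def near_graceful_labelling_def Let_def m_def[symmetric] by metis
qed

lemma bij_betw_if_subset_image:
  assumes "finite A" "card A = card B" "B \<subseteq> f ` A"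
  shows "bij_betw f A B"
proof -
  have "B = f ` A"
    using assms card_image_le[of A f] by (intro card_seteq) auto
  with assms show ?thesis
    by (auto simp: bij_betw_def intro: eq_card_imp_inj_on)
qed

lemma difference_labelling_hub:
  assumes verts: "verts G = insert c (A \<union> M)"
    and edges: "finite (edges G)" "\<And>v. v \<in> A \<Longrightarrow> {v, c} \<in> edges G"
    and hub: "f c = 0"
    and T: "card T = card (edges G)" "T \<subseteq> edge_diff f ` edges G" "T \<subseteq> {0<..N}"
    and M: "inj_on f M" "f ` M \<subseteq> {0<..N}" "f ` A \<inter> f ` M = {}"
  shows "difference_labelling G f N T"
proof -
  have bij: "bij_betw (edge_diff f) (edges G) T"
    using edges(1) T(1,2) by (intro bij_betw_if_subset_image) simp_all
  have spoke: "edge_diff f {v, c} = f v" for v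
    by (simp add: edge_diff_doubleton hub)
  have "f v \<in> T" if "v \<in> A" for v
    using bij_betwE[OF bij] edges(2)[OF that] spoke[of v] by metis
  then have A: "f ` A \<subseteq> {0<..N}"
    using T(3) by blast
  have "inj_on f A"
  proof
    fix v w assume vw: "v \<in> A" "w \<in> A" "f v = f w"
    then have "edge_diff f {v, c} = edge_diff f {w, c}"
      by (simp add: spoke)
    then have "{v, c} = {w, c}"
      using bij_betw_imp_inj_on[OF bij] edges(2) vw(1,2) by (blast dest: inj_onD)
    then show "v = w"
      by (auto simp: doubleton_eq_iff)
  qed
  with M(1,3) have "inj_on f (A \<union> M)"
    by (auto simp: inj_on_Un)
  moreover have "0 \<notin> f ` (A \<union> M)"
    using A M(2) by auto
  ultimately have "inj_on f (verts G)"
    unfolding verts by (auto simp: inj_on_insert hub)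
  moreover have "f ` verts G \<subseteq> {..N}"
    using A M(2) by (auto simp: verts hub)
  ultimately show ?thesis
    using bij by (simp add: difference_labelling_def)
qed

section \<open>Skolem pairings\<close>

text \<open>
  A pair \<open>(a, b)\<close> stands for a triangle whose vertices other than the centre are labelled \<open>a\<close> and
  \<open>b\<close>. The condition on the gaps forces \<open>a < b\<close>, so no subtraction is truncated.
\<close>

definition pair_ends :: "(nat \<times> nat) list \<Rightarrow> nat set" where
  "pair_ends ps = fst ` set ps \<union> snd ` set ps"

definition pair_gaps :: "(nat \<times> nat) list \<Rightarrow> nat set" where
  "pair_gaps ps = (\<lambda>(a, b). b - a) ` set ps"

definition skolem_pairing :: "nat \<Rightarrow> nat set \<Rightarrow> (nat \<times> nat) list \<Rightarrow> bool" where
  "skolem_pairing t P ps \<longleftrightarrow>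
     length ps = t \<and> card P = 2 * t \<and> pair_ends ps = P \<and> pair_gaps ps = {1..t}"

lemma pair_ends_simps [simp]:
  "pair_ends [] = {}"
  "pair_ends ((a, b) # ps) = {a, b} \<union> pair_ends ps"
  "pair_ends (ps @ ps') = pair_ends ps \<union> pair_ends ps'"
  by (auto simp: pair_ends_def)

lemma pair_gaps_simps [simp]:
  "pair_gaps [] = {}"
  "pair_gaps ((a, b) # ps) = insert (b - a) (pair_gaps ps)"
  "pair_gaps (ps @ ps') = pair_gaps ps \<union> pair_gaps ps'"
  by (auto simp: pair_gaps_def)

lemma skolem_pairingI:
  assumes length: "length ps = t" and card: "card P = 2 * t" and ends: "P \<subseteq> pair_ends ps"
    and even: "\<And>c. 1 \<le> c \<Longrightarrow> 2 * c \<le> t \<Longrightarrow> 2 * c \<in> pair_gaps ps"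
    and odd: "\<And>c. 2 * c + 1 \<le> t \<Longrightarrow> 2 * c + 1 \<in> pair_gaps ps"
  shows "skolem_pairing t P ps"
proof -
  have "d \<in> pair_gaps ps" if "1 \<le> d" "d \<le> t" for d
    by (cases "even d") (use that even odd in \<open>auto elim!: evenE oddE\<close>)
  moreover have "card (pair_gaps ps) \<le> card {1..t}"
    using card_image_le[of "set ps" "\<lambda>(a, b). b - a"] card_length[of ps]
    by (simp add: pair_gaps_def length)
  ultimately have "pair_gaps ps = {1..t}"
    by (intro card_seteq[symmetric]) (auto simp: pair_gaps_def)
  moreover have "card (pair_ends ps) \<le> card P"
    using card_Un_le[of "fst ` set ps" "snd ` set ps"] card_length[of ps]
      card_image_le[of "set ps" fst] card_image_le[of "set ps" snd]
    by (simp add: pair_ends_def card length)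
  then have "pair_ends ps = P"
    using ends by (intro card_seteq[symmetric]) (auto simp: pair_ends_def)
  ultimately show ?thesis
    by (simp add: skolem_pairing_def length card)
qed

lemma skolem_pairing_shift:
  assumes "skolem_pairing t P ps"
  shows "skolem_pairing t ((+) w ` P) (map (\<lambda>(a, b). (w + a, w + b)) ps)"
proof -
  have "pair_ends (map (\<lambda>(a, b). (w + a, w + b)) ps) = (+) w ` pair_ends ps"
    by (simp add: pair_ends_def image_Un image_image split_beta)
  moreover have "pair_gaps (map (\<lambda>(a, b). (w + a, w + b)) ps) = pair_gaps ps"
    by (simp add: pair_gaps_def image_image split_beta)
  ultimately show ?thesis
    using assms by (simp add: skolem_pairing_def card_image)
qed

definition nested_pairs :: "nat \<Rightarrow> nat \<Rightarrow> nat \<Rightarrow> (nat \<times> nat) list" where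
  "nested_pairs a b n = map (\<lambda>r. (a + r, b - r)) [0..<n]"

lemma length_nested_pairs [simp]: "length (nested_pairs a b n) = n"
  by (simp add: nested_pairs_def)

lemma pair_ends_nested_pairs [simp]:
  assumes "n \<le> b + 1"
  shows "pair_ends (nested_pairs a b n) = {a..<a + n} \<union> {b + 1 - n..<b + 1}"
proof -
  have "v \<in> (\<lambda>r. b - r) ` {0..<n}" if "v \<in> {b + 1 - n..<b + 1}" for v
    using that by (intro image_eqI[of _ _ "b - v"]) auto
  then have "(\<lambda>r. b - r) ` {0..<n} = {b + 1 - n..<b + 1}"
    using assms by auto
  then show ?thesis
    by (simp add: pair_ends_def nested_pairs_def image_image image_add_atLeastLessThan add.commute)
qed

lemma pair_gaps_nested_pairs [simp]:
  assumes "a + 2 * n \<le> b + 2"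
  shows "d \<in> pair_gaps (nested_pairs a b n) \<longleftrightarrow> even (a + b + d) \<and> a + d \<le> b \<and> b < a + d + 2 * n"
proof
  assume d: "even (a + b + d) \<and> a + d \<le> b \<and> b < a + d + 2 * n"
  then have "even (b - (a + d))"
    by (auto simp: even_diff_nat)
  then obtain r where "b = a + d + 2 * r"
    using d by (metis evenE le_add_diff_inverse)
  with d show "d \<in> pair_gaps (nested_pairs a b n)"
    by (auto simp: pair_gaps_def nested_pairs_def image_image intro!: image_eqI[of _ _ r])
qed (use assms in \<open>auto simp: pair_gaps_def nested_pairs_def\<close>)

lemma small_skolem_pairings:
  "skolem_pairing 0 {1..2 * 0} []"
  "skolem_pairing 1 {1..2 * 1} [(1, 2)]"
  "skolem_pairing 4 {1..2 * 4} [(1, 2), (4, 6), (5, 8), (3, 7)]"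
  "skolem_pairing 5 {1..2 * 5} [(1, 2), (4, 6), (7, 10), (5, 9), (3, 8)]"
  by code_simp+

lemma small_hooked_skolem_pairings:
  "skolem_pairing 2 ({1..2 * 2 - 1} \<union> {2 * 2 + 1}) [(1, 2), (3, 5)]"
  "skolem_pairing 3 ({1..2 * 3 - 1} \<union> {2 * 3 + 1}) [(2, 3), (5, 7), (1, 4)]"
  by code_simp+

text \<open>
  In each of the following pairings a long nest realises the even gaps and two short nests the odd
  ones; the single pairs supply the gaps that are left over.
\<close>

lemma skolem_pairing_mod_4_eq_0:
  "skolem_pairing (4 * p + 8) {1..2 * (4 * p + 8)}
     (nested_pairs (4 * p + 8) (8 * p + 16) (2 * p + 4) @ nested_pairs 1 (4 * p + 6) p @
      nested_pairs (p + 4) (3 * p + 5) p @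
      [(p + 1, 3 * p + 6), (p + 2, p + 3), (2 * p + 4, 4 * p + 7), (2 * p + 5, 6 * p + 12)])"
  (is "skolem_pairing _ ?P ?ps")
proof (rule skolem_pairingI)
  show "?P \<subseteq> pair_ends ?ps"
    by (simp add: subset_iff) linarith
next
  fix c assume "2 * c + 1 \<le> 4 * p + 8"
  then show "2 * c + 1 \<in> pair_gaps ?ps"
    by simp presburger
qed simp_all

lemma skolem_pairing_mod_4_eq_1:
  "skolem_pairing (4 * p + 9) {1..2 * (4 * p + 9)}
     (nested_pairs (4 * p + 10) (8 * p + 18) (2 * p + 4) @ nested_pairs 1 (4 * p + 8) (p + 2) @
      nested_pairs (p + 5) (3 * p + 6) p @
      [(p + 3, p + 4), (2 * p + 5, 6 * p + 14), (2 * p + 6, 4 * p + 9)])"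
  (is "skolem_pairing _ ?P ?ps")
proof (rule skolem_pairingI)
  show "?P \<subseteq> pair_ends ?ps"
    by (simp add: subset_iff) linarith
next
  fix c assume "1 \<le> c" "2 * c \<le> 4 * p + 9"
  then show "2 * c \<in> pair_gaps ?ps"
    by simp presburger
next
  fix c assume "2 * c + 1 \<le> 4 * p + 9"
  then show "2 * c + 1 \<in> pair_gaps ?ps"
    by simp presburger
qed simp_all

lemma hooked_skolem_pairing_mod_4_eq_2:
  "skolem_pairing (4 * p + 6) ({1..2 * (4 * p + 6) - 1} \<union> {2 * (4 * p + 6) + 1})
     (nested_pairs 1 (4 * p + 5) (2 * p + 2) @ nested_pairs (4 * p + 8) (8 * p + 11) p @
      nested_pairs (5 * p + 8) (7 * p + 9) p @
      [(2 * p + 3, 6 * p + 8), (4 * p + 6, 6 * p + 9), (4 * p + 7, 8 * p + 13),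
       (7 * p + 10, 7 * p + 11)])"
  (is "skolem_pairing _ ?P ?ps")
proof (rule skolem_pairingI)
  show "?P \<subseteq> pair_ends ?ps"
    by (simp add: subset_iff) linarith
next
  fix c assume "1 \<le> c" "2 * c \<le> 4 * p + 6"
  then show "2 * c \<in> pair_gaps ?ps"
    by simp presburger
next
  fix c assume "2 * c + 1 \<le> 4 * p + 6"
  then show "2 * c + 1 \<in> pair_gaps ?ps"
    by simp presburger
qed simp_all

lemma hooked_skolem_pairing_mod_4_eq_3:
  "skolem_pairing (4 * p + 7) ({1..2 * (4 * p + 7) - 1} \<union> {2 * (4 * p + 7) + 1})
     (nested_pairs (4 * p + 9) (8 * p + 13) (2 * p + 2) @ nested_pairs 1 (4 * p + 6) p @
      nested_pairs (p + 4) (3 * p + 5) p @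
      [(p + 1, 3 * p + 6), (p + 2, p + 3), (2 * p + 4, 4 * p + 7), (2 * p + 5, 6 * p + 11),
       (4 * p + 8, 8 * p + 15)])"
  (is "skolem_pairing _ ?P ?ps")
proof (rule skolem_pairingI)
  show "?P \<subseteq> pair_ends ?ps"
    by (simp add: subset_iff) linarith
next
  fix c assume "1 \<le> c" "2 * c \<le> 4 * p + 7"
  then show "2 * c \<in> pair_gaps ?ps"
    by simp presburger
next
  fix c assume "2 * c + 1 \<le> 4 * p + 7"
  then show "2 * c + 1 \<in> pair_gaps ?ps"
    by simp presburger
qed simp_all

lemma ex_skolem_pairing:
  assumes "t mod 4 = 0 \<or> t mod 4 = 1"
  shows "\<exists>ps. skolem_pairing t {1..2 * t} ps"
proof -
  define p where "p = t div 4 - 2"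
  have "t = 0 \<or> t = 1 \<or> t = 4 \<or> t = 5 \<or> t = 4 * p + 8 \<or> t = 4 * p + 9"
    using assms unfolding p_def by presburger
  then show ?thesis
    using small_skolem_pairings skolem_pairing_mod_4_eq_0[of p] skolem_pairing_mod_4_eq_1[of p]
    by metis
qed

lemma ex_hooked_skolem_pairing:
  assumes "t mod 4 = 2 \<or> t mod 4 = 3"
  shows "\<exists>ps. skolem_pairing t ({1..2 * t - 1} \<union> {2 * t + 1}) ps"
proof -
  define p where "p = t div 4 - 1"
  have "t = 2 \<or> t = 3 \<or> t = 4 * p + 6 \<or> t = 4 * p + 7"
    using assms unfolding p_def by presburger
  then show ?thesis
    using small_hooked_skolem_pairings
      hooked_skolem_pairing_mod_4_eq_2[of p] hooked_skolem_pairing_mod_4_eq_3[of p]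
    by metis
qed

section \<open>Filling an interval with the edge labels of squares\<close>

text \<open>
  A triple \<open>(x, y, z)\<close> stands for a square whose vertices other than the centre are labelled \<open>x\<close>,
  \<open>y\<close> and \<open>z\<close> in cyclic order. In a filling all edge labels are positive, so no subtraction is
  truncated.
\<close>

definition opposite_labels :: "(nat \<times> nat \<times> nat) list \<Rightarrow> nat list" where
  "opposite_labels qs = map (\<lambda>(x, y, z). y) qs"

definition spoke_labels :: "(nat \<times> nat \<times> nat) list \<Rightarrow> nat set" where
  "spoke_labels qs = (\<Union>(x, y, z)\<in>set qs. {x, z})"

definition square_edge_labels :: "(nat \<times> nat \<times> nat) list \<Rightarrow> nat set" where
  "square_edge_labels qs = (\<Union>(x, y, z)\<in>set qs. {x, z, x - y, z - y})"

definition square_filling :: "nat \<Rightarrow> (nat \<times> nat \<times> nat) list \<Rightarrow> bool" where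
  "square_filling u qs \<longleftrightarrow>
     square_edge_labels qs = {u<..u + 4 * length qs} \<and>
     distinct (opposite_labels qs) \<and> 0 \<notin> set (opposite_labels qs) \<and>
     spoke_labels qs \<inter> set (opposite_labels qs) = {}"

lemma opposite_labels_simps [simp]:
  "opposite_labels [] = []"
  "opposite_labels ((x, y, z) # qs) = y # opposite_labels qs"
  "opposite_labels (qs @ rs) = opposite_labels qs @ opposite_labels rs"
  by (simp_all add: opposite_labels_def)

lemma spoke_labels_simps [simp]:
  "spoke_labels [] = {}"
  "spoke_labels ((x, y, z) # qs) = {x, z} \<union> spoke_labels qs"
  "spoke_labels (qs @ rs) = spoke_labels qs \<union> spoke_labels rs"
  by (auto simp: spoke_labels_def)

lemma square_edge_labels_simps [simp]:
  "square_edge_labels [] = {}"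
  "square_edge_labels ((x, y, z) # qs) = {x, z, x - y, z - y} \<union> square_edge_labels qs"
  "square_edge_labels (qs @ rs) = square_edge_labels qs \<union> square_edge_labels rs"
  by (auto simp: square_edge_labels_def)

lemma spoke_labels_subset_edge_labels: "spoke_labels qs \<subseteq> square_edge_labels qs"
  by (auto simp: spoke_labels_def square_edge_labels_def)

lemma square_filling_opposite_labels:
  assumes "square_filling u qs"
  shows "set (opposite_labels qs) \<subseteq> {0<..<u + 4 * length qs}"
proof
  fix y assume y: "y \<in> set (opposite_labels qs)"
  then obtain x z where "(x, y, z) \<in> set qs"
    by (auto simp: opposite_labels_def)
  then have "{x, x - y} \<subseteq> square_edge_labels qs"
    by (auto simp: square_edge_labels_def)
  moreover have "0 < y"
    using y assms unfolding square_filling_def by (metis gr0I)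
  ultimately show "y \<in> {0<..<u + 4 * length qs}"
    using assms by (auto simp: square_filling_def)
qed

lemma square_filling_append:
  assumes qs: "square_filling u qs" and rs: "square_filling (u + 4 * length qs) rs"
    and new: "set (opposite_labels rs) \<inter> (spoke_labels qs \<union> set (opposite_labels qs)) = {}"
  shows "square_filling u (qs @ rs)"
proof -
  have "square_edge_labels (qs @ rs) = {u<..u + 4 * length (qs @ rs)}"
    using qs rs by (auto simp: square_filling_def)
  moreover have "spoke_labels rs \<inter> set (opposite_labels qs) = {}"
    using square_filling_opposite_labels[OF qs] spoke_labels_subset_edge_labels[of rs] rs
    by (fastforce simp: square_filling_def)
  ultimately show ?thesis
    using qs rs new unfolding square_filling_def by auto
qed

text \<open>
  The opposite labels of a run advance in steps of two, so that \<open>x - y\<close> and \<open>z - y\<close> descend in steps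
  of one. The second run of a block uses the opposite labels left out by the first.
\<close>

definition square_run :: "nat \<Rightarrow> nat \<Rightarrow> nat \<Rightarrow> nat \<Rightarrow> (nat \<times> nat \<times> nat) list" where
  "square_run x y z n = map (\<lambda>i. (x + i, y + 2 * i, z + i)) [0..<n]"

lemma length_square_run [simp]: "length (square_run x y z n) = n"
  by (simp add: square_run_def)

lemma opposite_labels_square_run [simp]:
  "opposite_labels (square_run x y z n) = map (\<lambda>i. y + 2 * i) [0..<n]"
  by (simp add: opposite_labels_def square_run_def)

lemma spoke_labels_square_run [simp]:
  "spoke_labels (square_run x y z n) = {x..<x + n} \<union> {z..<z + n}"
proof -
  have "spoke_labels (square_run x y z n) = (+) x ` {0..<n} \<union> (+) z ` {0..<n}"
    by (auto simp: spoke_labels_def square_run_def simp del: image_add_atLeastLessThan)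
  then show ?thesis
    by (simp add: add.commute)
qed

lemma square_edge_labels_square_run [simp]:
  assumes "y + n \<le> x + 1" "y + n \<le> z + 1"
  shows "square_edge_labels (square_run x y z n) = {x..<x + n} \<union> {z..<z + n} \<union>
    {x + 1 - (y + n)..<x + 1 - y} \<union> {z + 1 - (y + n)..<z + 1 - y}"
proof -
  have diff: "(\<lambda>i. v + i - (y + 2 * i)) ` {0..<n} = {v + 1 - (y + n)..<v + 1 - y}"
    if "y + n \<le> v + 1" for v
  proof
    show "{v + 1 - (y + n)..<v + 1 - y} \<subseteq> (\<lambda>i. v + i - (y + 2 * i)) ` {0..<n}"
    proof
      fix l assume "l \<in> {v + 1 - (y + n)..<v + 1 - y}"
      with that show "l \<in> (\<lambda>i. v + i - (y + 2 * i)) ` {0..<n}"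
        by (intro image_eqI[of _ _ "v - y - l"]) auto
    qed
  qed (use that in auto)
  have "square_edge_labels (square_run x y z n) = spoke_labels (square_run x y z n) \<union>
    (\<lambda>i. x + i - (y + 2 * i)) ` {0..<n} \<union> (\<lambda>i. z + i - (y + 2 * i)) ` {0..<n}"
    by (auto simp: square_edge_labels_def spoke_labels_def square_run_def)
  then show ?thesis
    by (simp only: diff assms spoke_labels_square_run)
qed

definition square_block :: "nat \<Rightarrow> nat \<Rightarrow> (nat \<times> nat \<times> nat) list" where
  "square_block u k =
     square_run (u + 4 * k + 3) (3 * k + 2) (u + 6 * k + 4) (k + 1) @
     square_run (u + 5 * k + 4) (3 * k + 3) (u + 7 * k + 5) k"

lemma length_square_block [simp]: "length (square_block u k) = 2 * k + 1"
  by (simp add: square_block_def)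

lemma set_opposite_labels_square_block:
  "set (opposite_labels (square_block u k)) \<subseteq> {3 * k + 2..5 * k + 2}"
  by (auto simp: square_block_def)

lemma square_filling_square_block:
  assumes "k \<le> u"
  shows "square_filling u (square_block u k)"
proof -
  have "square_edge_labels (square_block u k) = {u<..u + 4 * length (square_block u k)}"
    using assms by (auto simp: square_block_def)
  moreover have "distinct (opposite_labels (square_block u k))"
  proof -
    have "3 * k + 2 + 2 * i \<noteq> 3 * k + 3 + 2 * j" for i j
      by presburger
    then show ?thesis
      by (auto simp: square_block_def distinct_map inj_on_def)
  qed
  moreover have "spoke_labels (square_block u k) \<subseteq> {u + 4 * k + 3..}"
    by (auto simp: square_block_def)
  then have "spoke_labels (square_block u k) \<inter> set (opposite_labels (square_block u k)) = {}"
    using set_opposite_labels_square_block[of u k] assms by fastforce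
  moreover have "0 \<notin> set (opposite_labels (square_block u k))"
    using set_opposite_labels_square_block[of u k] by auto
  ultimately show ?thesis
    by (simp add: square_filling_def)
qed

lemma square_filling_two_blocks:
  fixes u j k :: nat
  defines "v \<equiv> u + 4 * (2 * j + 1)"
  assumes "j \<le> u" "k \<le> v" "v < 3 * k + 2"
  shows "square_filling u (square_block u j @ square_block v k)"
proof (rule square_filling_append)
  show first: "square_filling u (square_block u j)"
    by (rule square_filling_square_block) fact
  show "square_filling (u + 4 * length (square_block u j)) (square_block v k)"
    using assms by (simp add: square_filling_square_block)
  have "spoke_labels (square_block u j) \<union> set (opposite_labels (square_block u j)) \<subseteq> {..v}"
    using first square_filling_opposite_labels[OF first]
      spoke_labels_subset_edge_labels[of "square_block u j"]
    by (auto simp: square_filling_def v_def)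
  then show "set (opposite_labels (square_block v k)) \<inter>
      (spoke_labels (square_block u j) \<union> set (opposite_labels (square_block u j))) = {}"
    using set_opposite_labels_square_block[of v k] \<open>v < 3 * k + 2\<close> by fastforce
qed

lemma square_filling_snoc:
  fixes u :: nat and qs :: "(nat \<times> nat \<times> nat) list"
  defines "v \<equiv> u + 4 * length qs"
  assumes qs: "square_filling u qs" and "0 < u" and opposite: "1 \<notin> set (opposite_labels qs)"
  shows "square_filling u (qs @ [(v + 4, 1, v + 2)])"
proof (rule square_filling_append[OF qs])
  show "square_filling (u + 4 * length qs) [(v + 4, 1, v + 2)]"
    by (auto simp: square_filling_def v_def)
  have "1 \<notin> spoke_labels qs"
    using qs \<open>0 < u\<close> spoke_labels_subset_edge_labels[of qs] by (auto simp: square_filling_def)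
  with opposite show "set (opposite_labels [(v + 4, 1, v + 2)]) \<inter>
      (spoke_labels qs \<union> set (opposite_labels qs)) = {}"
    by simp
qed

lemma ex_square_filling_up_to_parity:
  assumes "2 \<le> u" "1 \<le> s" "s \<le> 20 * u + 11"
  shows "\<exists>qs. square_filling u qs \<and> 1 \<notin> set (opposite_labels qs) \<and>
    (length qs = s \<or> length qs + 1 = s)"
proof (cases "s \<le> 2 * u + 2")
  case True
  define k where "k = (s - 1) div 2"
  have "k \<le> u" "2 * k + 1 = s \<or> 2 * k + 1 + 1 = s"
    using True \<open>1 \<le> s\<close> unfolding k_def by linarith+
  then show ?thesis
    using square_filling_square_block[of k u] set_opposite_labels_square_block[of u k]
    by (intro exI[of _ "square_block u k"]) auto
next
  case False
  define h where "h = (s - 2) div 2"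
  \<comment> \<open>For \<open>h = j + k\<close>, raising \<open>j\<close> by one changes \<open>k - v\<close> by \<open>-9\<close>: this \<open>j\<close> gives \<open>k \<le> v < 3 * k + 2\<close>.\<close>
  define j where "j = (h + 4 - u) div 9"
  define v where "v = u + 4 * (2 * j + 1)"
  have h: "u \<le> h" "h \<le> 10 * u + 4" "2 * h + 2 = s \<or> 2 * h + 2 + 1 = s"
    using False assms unfolding h_def by linarith+
  have j: "j \<le> u" "9 * j + u \<le> h + 4" "h \<le> 9 * j + u + 4"
    using h unfolding j_def by linarith+
  moreover have "j \<le> h"
    using h(1) j(1) by linarith
  then obtain k where k: "h = j + k"
    using le_Suc_ex by blast
  moreover have "v < 3 * k + 2"
  proof (cases "j = 0")
    case True
    then show ?thesis
      using h(1) k \<open>2 \<le> u\<close> by (simp add: v_def)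
  next
    case False
    then show ?thesis
      using h(1) k j(2) by (simp add: v_def)
  qed
  ultimately have "square_filling u (square_block u j @ square_block v k)"
    unfolding v_def by (intro square_filling_two_blocks) auto
  then show ?thesis
    using h(3) k set_opposite_labels_square_block[of u j] set_opposite_labels_square_block[of v k]
    by (intro exI[of _ "square_block u j @ square_block v k"]) auto
qed

lemma ex_square_filling:
  assumes "2 \<le> u" "s \<le> 20 * u + 11"
  shows "\<exists>qs. length qs = s \<and> square_filling u qs"
proof (cases "s = 0")
  case True
  then show ?thesis
    by (auto simp: square_filling_def)
next
  case False
  then obtain qs where qs: "square_filling u qs" "1 \<notin> set (opposite_labels qs)"
      "length qs = s \<or> length qs + 1 = s"
    using ex_square_filling_up_to_parity[of u s] assms by auto
  show ?thesis
  proof (cases "length qs = s")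
    case False
    then have "length (qs @ [(u + 4 * length qs + 4, 1, u + 4 * length qs + 2)]) = s"
      using qs(3) by simp
    then show ?thesis
      using square_filling_snoc[OF qs(1) _ qs(2)] \<open>2 \<le> u\<close> by (metis zero_less_numeral less_le_trans)
  qed (use qs in blast)
qed

section \<open>Labelling the bouquet\<close>

lemma nth_image_lessThan_length: "(!) xs ` {..<length xs} = set xs"
  by (simp add: nth_image lessThan_atLeast0)

definition hub_neighbours :: "nat \<Rightarrow> nat \<Rightarrow> (bouquet_vertex + bouquet_vertex) set" where
  "hub_neighbours t s =
     (\<Union>i<t. {Inl (Rim i 1), Inl (Rim i 2)}) \<union> (\<Union>i<s. {Inr (Rim i 1), Inr (Rim i 3)})"

definition opposite_vertices :: "nat \<Rightarrow> (bouquet_vertex + bouquet_vertex) set" where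
  "opposite_vertices s = (\<lambda>i. Inr (Rim i 2)) ` {..<s}"

lemma verts_C3C4_graph_conv_hub:
  "verts (C3C4_graph t s) = insert (Inl Center) (hub_neighbours t s \<union> opposite_vertices s)"
  by (auto simp: verts_C3C4_graph hub_neighbours_def opposite_vertices_def)

lemma hub_edge_C3C4_graph:
  "v \<in> hub_neighbours t s \<Longrightarrow> {v, Inl Center} \<in> edges (C3C4_graph t s)"
  unfolding hub_neighbours_def edges_C3C4_graph by blast

fun bouquet_label ::
  "(nat \<times> nat) list \<Rightarrow> (nat \<times> nat \<times> nat) list \<Rightarrow> bouquet_vertex + bouquet_vertex \<Rightarrow> nat" where
  "bouquet_label ps qs (Inl (Rim i j)) = (if j = 1 then fst (ps ! i) else snd (ps ! i))"
| "bouquet_label ps qs (Inr (Rim i j)) =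
     (case qs ! i of (x, y, z) \<Rightarrow> if j = 1 then x else if j = 2 then y else z)"
| "bouquet_label ps qs _ = 0"

lemma bouquet_label_hub_neighbours:
  "bouquet_label ps qs ` hub_neighbours (length ps) (length qs) = pair_ends ps \<union> spoke_labels qs"
proof -
  have "pair_ends ps = (\<Union>i<length ps. {fst (ps ! i), snd (ps ! i)})"
    by (auto simp: pair_ends_def image_image simp flip: nth_image_lessThan_length)
  moreover have "spoke_labels qs = (\<Union>i<length qs. case qs ! i of (x, y, z) \<Rightarrow> {x, z})"
    by (simp add: spoke_labels_def image_image flip: nth_image_lessThan_length)
  ultimately show ?thesis
    by (simp add: hub_neighbours_def image_Un image_UN split_beta)
qed

lemma bouquet_label_opposite_vertices:
  "bouquet_label ps qs ` opposite_vertices (length qs) = set (opposite_labels qs)"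
  by (simp add: opposite_vertices_def opposite_labels_def image_image split_beta
      flip: nth_image_lessThan_length)

lemma inj_on_bouquet_label_opposite_vertices:
  assumes "distinct (opposite_labels qs)"
  shows "inj_on (bouquet_label ps qs) (opposite_vertices (length qs))"
  using assms
  by (auto simp: inj_on_def opposite_vertices_def opposite_labels_def distinct_conv_nth split_beta)

lemma bouquet_label_hub_neighbours_Int_opposite_vertices:
  assumes qs: "square_filling u qs" and ps: "pair_ends ps \<subseteq> {u + 4 * length qs<..}"
  shows "bouquet_label ps qs ` hub_neighbours (length ps) (length qs) \<inter>
    bouquet_label ps qs ` opposite_vertices (length qs) = {}"
proof -
  have "{u + 4 * length qs<..} \<inter> {0<..<u + 4 * length qs} = {}"
    by auto
  then have "pair_ends ps \<inter> set (opposite_labels qs) = {}"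
    using ps square_filling_opposite_labels[OF qs] by blast
  moreover have "spoke_labels qs \<inter> set (opposite_labels qs) = {}"
    using qs by (simp add: square_filling_def)
  ultimately show ?thesis
    unfolding bouquet_label_hub_neighbours bouquet_label_opposite_vertices by blast
qed

lemma pair_labels_subset_edge_diff:
  "pair_ends ps \<union> pair_gaps ps \<subseteq>
     insert 0 (edge_diff (bouquet_label ps qs) ` edges (C3C4_graph (length ps) s))"
  (is "_ \<subseteq> insert 0 (edge_diff ?f ` ?E)")
proof -
  have "{a, b, b - a} \<subseteq> insert 0 (edge_diff ?f ` ?E)" if "(a, b) \<in> set ps" for a b
  proof -
    obtain i where i: "i < length ps" "ps ! i = (a, b)"
      using \<open>(a, b) \<in> set ps\<close> by (metis in_set_conv_nth)
    have "{Inl (Rim i 1), Inl Center} \<in> ?E" "{Inl (Rim i 2), Inl Center} \<in> ?E"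
      "{Inl (Rim i 2), Inl (Rim i 1)} \<in> ?E"
      using i(1) unfolding edges_C3C4_graph by blast+
    from this[THEN truncated_diff_in_edge_diff_image, of ?f] show ?thesis
      by (simp add: i(2))
  qed
  then show ?thesis
    unfolding pair_ends_def pair_gaps_def by fastforce
qed

lemma square_edge_labels_subset_edge_diff:
  "square_edge_labels qs \<subseteq>
     insert 0 (edge_diff (bouquet_label ps qs) ` edges (C3C4_graph t (length qs)))"
  (is "_ \<subseteq> insert 0 (edge_diff ?f ` ?E)")
proof -
  have "{x, z, x - y, z - y} \<subseteq> insert 0 (edge_diff ?f ` ?E)" if "(x, y, z) \<in> set qs" for x y z
  proof -
    obtain i where i: "i < length qs" "qs ! i = (x, y, z)"
      using \<open>(x, y, z) \<in> set qs\<close> by (metis in_set_conv_nth)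
    have "{Inr (Rim i 1), Inl Center} \<in> ?E" "{Inr (Rim i 3), Inl Center} \<in> ?E"
      "{Inr (Rim i 1), Inr (Rim i 2)} \<in> ?E" "{Inr (Rim i 3), Inr (Rim i 2)} \<in> ?E"
      using i(1) unfolding edges_C3C4_graph by blast+
    from this[THEN truncated_diff_in_edge_diff_image, of ?f] show ?thesis
      by (simp add: i(2))
  qed
  then show ?thesis
    unfolding square_edge_labels_def by fastforce
qed

lemma difference_labelling_C3C4_graph:
  fixes t s :: nat
  defines "w \<equiv> t + 4 * s"
  assumes ps: "skolem_pairing t Q ps" and Q: "Q \<subseteq> {w<..N}" and "w \<le> N"
    and qs: "square_filling t qs" "length qs = s"
  shows "difference_labelling (C3C4_graph t s) (bouquet_label ps qs) N ({1..w} \<union> Q)"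
proof (rule difference_labelling_hub[OF verts_C3C4_graph_conv_hub])
  let ?E = "edges (C3C4_graph t s)" and ?f = "bouquet_label ps qs" and ?T = "{1..w} \<union> Q"
  have pairs: "length ps = t" "card Q = 2 * t" "pair_ends ps = Q" "pair_gaps ps = {1..t}"
    using ps by (simp_all add: skolem_pairing_def)
  have squares: "square_edge_labels qs = {t<..w}" "set (opposite_labels qs) \<subseteq> {0<..<w}"
    using qs square_filling_opposite_labels[OF qs(1)] by (simp_all add: square_filling_def w_def)
  show "finite ?E" by (simp add: edges_C3C4_graph)
  show "{v, Inl Center} \<in> ?E" if "v \<in> hub_neighbours t s" for v
    using that by (rule hub_edge_C3C4_graph)
  show "?f (Inl Center) = 0" by simp
  have "finite Q" "{1..w} \<inter> Q = {}"
    using Q finite_subset by auto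
  then show "card ?T = card ?E"
    by (simp add: card_Un_disjoint pairs(2) card_edges_C3C4_graph w_def)
  show "?T \<subseteq> {0<..N}"
    using Q \<open>w \<le> N\<close> by auto
  show "?T \<subseteq> edge_diff ?f ` ?E"
  proof -
    have "?T = pair_ends ps \<union> pair_gaps ps \<union> square_edge_labels qs"
      by (auto simp: pairs squares w_def)
    then have "?T \<subseteq> insert 0 (edge_diff ?f ` ?E)"
      using pair_labels_subset_edge_diff[of ps qs s] square_edge_labels_subset_edge_diff[of qs ps t]
      unfolding pairs(1) qs(2) by simp
    moreover have "0 \<notin> ?T"
      using Q by auto
    ultimately show ?thesis
      by blast
  qed
  show "inj_on ?f (opposite_vertices s)"
    using inj_on_bouquet_label_opposite_vertices[of qs ps] qs by (simp add: square_filling_def)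
  show "?f ` opposite_vertices s \<subseteq> {0<..N}"
    using bouquet_label_opposite_vertices[of ps qs] squares(2) qs(2) \<open>w \<le> N\<close> by auto
  have "pair_ends ps \<subseteq> {t + 4 * length qs<..}"
    using Q by (auto simp: pairs(3) qs(2) w_def)
  from bouquet_label_hub_neighbours_Int_opposite_vertices[OF qs(1) this]
  show "?f ` hub_neighbours t s \<inter> ?f ` opposite_vertices s = {}"
    by (simp add: pairs(1) qs(2))
qed

lemma ex_difference_labelling_C3C4_graph:
  assumes ps: "skolem_pairing t P ps" and P: "P \<subseteq> {1..n}"
    and ts: "2 \<le> t" "s \<le> 20 * t + 11"
  shows "\<exists>f. difference_labelling (C3C4_graph t s) f (t + 4 * s + n)
    ({1..t + 4 * s} \<union> (+) (t + 4 * s) ` P)"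
proof -
  obtain qs where qs: "square_filling t qs" "length qs = s"
    using ex_square_filling[OF ts] by blast
  have "(+) (t + 4 * s) ` P \<subseteq> {t + 4 * s<..t + 4 * s + n}"
    using P by auto
  from difference_labelling_C3C4_graph[OF skolem_pairing_shift[OF ps] this _ qs]
  show ?thesis
    by auto
qed

theorem graceful_C3C4_graph:
  assumes "2 \<le> t" "s \<le> 20 * t + 11" "t mod 4 = 0 \<or> t mod 4 = 1"
  shows "graceful (C3C4_graph t s)"
proof -
  obtain ps where "skolem_pairing t {1..2 * t} ps"
    using ex_skolem_pairing[OF assms(3)] by blast
  then obtain f where f: "difference_labelling (C3C4_graph t s) f (t + 4 * s + 2 * t)
      ({1..t + 4 * s} \<union> (+) (t + 4 * s) ` {1..2 * t})"
    using ex_difference_labelling_C3C4_graph[OF _ order_refl assms(1,2)] by blast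
  have "{1..t + 4 * s} \<union> (+) (t + 4 * s) ` {1..2 * t} = {1..3 * t + 4 * s}"
    by auto
  with f show ?thesis
    by (intro graceful_if_difference_labelling[of _ f])
      (simp add: card_edges_C3C4_graph algebra_simps)
qed

theorem near_graceful_C3C4_graph:
  assumes "2 \<le> t" "s \<le> 20 * t + 11" "t mod 4 = 2 \<or> t mod 4 = 3"
  shows "near_graceful (C3C4_graph t s)"
proof -
  let ?P = "{1..2 * t - 1} \<union> {2 * t + 1}"
  have P: "?P \<subseteq> {1..2 * t + 1}" by auto
  obtain ps where "skolem_pairing t ?P ps"
    using ex_hooked_skolem_pairing[OF assms(3)] by blast
  then obtain f where f: "difference_labelling (C3C4_graph t s) f (t + 4 * s + (2 * t + 1))
      ({1..t + 4 * s} \<union> (+) (t + 4 * s) ` ?P)"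
    using ex_difference_labelling_C3C4_graph[OF _ P assms(1,2)] by blast
  have "{1..t + 4 * s} \<union> (+) (t + 4 * s) ` ?P = {1..3 * t + 4 * s - 1} \<union> {3 * t + 4 * s + 1}"
    using \<open>2 \<le> t\<close> by auto
  with f show ?thesis
    by (intro near_graceful_if_difference_labelling[of _ f])
      (simp add: card_edges_C3C4_graph algebra_simps)
qed

theorem theorem4p2:
  fixes t s :: nat
  assumes "4 \<le> t" and "t \<le> s" and "real s \<le> (13 * real t + 37) / 2"
  shows "(t mod 4 = 0 \<or> t mod 4 = 1 \<longrightarrow> graceful (C3C4_graph t s)) \<and>
         (t mod 4 = 2 \<or> t mod 4 = 3 \<longrightarrow> near_graceful (C3C4_graph t s))"
proof -
  have "real s \<le> real (20 * t + 11)"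
    using assms(1,3) by simp
  then have "2 \<le> t" "s \<le> 20 * t + 11"
    using assms(1) by simp_all
  then show ?thesis
    by (intro conjI impI graceful_C3C4_graph near_graceful_C3C4_graph)
qed

end
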